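(* Let $I\subseteq\mathbb{R}$ be an interval with interior $I^{\circ}$, let $f:I\to\mathbb{R}$ be differentiable on $I^{\circ}$, and let $a,b\in I^{\circ}$ with $a<b$ be such that $f'\in L[a,b]$. Let $p>1$, $q=\frac{p}{p-1}$, and suppose $|f'|^{\frac{p}{p-1}}$ is convex on $[a,b]$. Then for every division $d: a=x_0<x_1<\dots<x_{n-1}<x_n=b$ of $[a,b]$, the trapezoidal error satisfies $$|E(f,d)|\le\left(\frac{1}{p+1}\right)^{\frac1p}\left(\frac12\right)^{\frac1q}\sum_{i=0}^{n-1}\frac{(x_{i+1}-x_i)^2}{2}\left(|f'(x_i)|+|f'(x_{i+1})|\right).$$
   Context: $f'\in L[a,b]$ means that $f'$ is (Lebesgue) integrable on $[a,b]$. For a division $d: a=x_0<x_1<\dots<x_n=b$, the trapezoidal sum is $T(f,d)=\sum_{i=0}^{n-1}\frac{f(x_i)+f(x_{i+1})}{2}(x_{i+1}-x_i)$, and the error $E(f,d)$ is defined by $\int_a^b f(x)\,dx=T(f,d)+E(f,d)$. *)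

theory Defs
  imports "HOL-Analysis.Analysis"
begin

text \<open>The division \<open>a = x 0 < x 1 < \<dots> < x n = b\<close>; values \<open>x i\<close> with \<open>i > n\<close> are irrelevant.\<close>

definition is_division :: "real \<Rightarrow> real \<Rightarrow> nat \<Rightarrow> (nat \<Rightarrow> real) \<Rightarrow> bool" where
  "is_division a b n x \<longleftrightarrow> x 0 = a \<and> x n = b \<and> (\<forall>i<n. x i < x (Suc i))"

definition trapezoidal_sum :: "(real \<Rightarrow> real) \<Rightarrow> nat \<Rightarrow> (nat \<Rightarrow> real) \<Rightarrow> real" where
  "trapezoidal_sum f n x = (\<Sum>i<n. (f (x i) + f (x (Suc i))) / 2 * (x (Suc i) - x i))"

definition trapezoidal_error :: "(real \<Rightarrow> real) \<Rightarrow> nat \<Rightarrow> (nat \<Rightarrow> real) \<Rightarrow> real" where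
  "trapezoidal_error f n x = integral {x 0..x n} f - trapezoidal_sum f n x"

end

theory Submission
  imports Defs
begin

text \<open>On a cell \<open>[c, d]\<close> with midpoint \<open>m\<close>, integration by parts shows that the error of the
  trapezoidal rule is \<open>\<integral> (m - t) f'(t) dt\<close>. By convexity \<open>\<bar>f'\<bar>\<close> is at most \<open>L powr (1 / q)\<close>, where \<open>L\<close>
  interpolates \<open>\<bar>f'\<bar> powr q\<close> linearly between \<open>c\<close> and \<open>d\<close>. Holder's inequality reduces the bound
  to the integrals of \<open>\<bar>t - m\<bar> powr p\<close> and \<open>L\<close>, both explicit, and superadditivity of \<open>y powr q\<close>
  turns \<open>(\<alpha> powr q + \<beta> powr q) powr (1 / q)\<close> into \<open>\<alpha> + \<beta>\<close>.\<close>

text \<open>Holder's inequality follows by integrating Young's inequality for \<open>u\<close> and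
  \<open>v\<close> scaled to norm one; positivity of \<open>X\<close> and \<open>Y\<close> allows
  this scaling. Only the values of three integrals enter, with \<open>w\<close> merely dominated by
  the product \<open>u t * v t\<close>.\<close>

lemma Holder_has_integral_le:
  fixes u v w :: "real \<Rightarrow> real"
  assumes "p > 1" "q > 1" "1 / p + 1 / q = 1" "X > 0" "Y > 0"
    and X: "((\<lambda>t. u t powr p) has_integral X) S"
    and Y: "((\<lambda>t. v t powr q) has_integral Y) S"
    and W: "(w has_integral W) S"
    and w: "\<And>t. t \<in> S \<Longrightarrow> 0 \<le> u t \<and> 0 \<le> v t \<and> \<bar>w t\<bar> \<le> u t * v t"
  shows "\<bar>W\<bar> \<le> X powr (1 / p) * Y powr (1 / q)"
proof -
  define U where "U = X powr (1 / p)"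
  define V where "V = Y powr (1 / q)"
  have UV: "U > 0" "V > 0" "U powr p = X" "V powr q = Y"
    using assms(1-5) by (simp_all add: U_def V_def powr_powr)
  \<comment> \<open>Young's bound for \<open>(u t / U) * (v t / V)\<close>, multiplied back by
    \<open>U * V\<close>. Since \<open>1 / p + 1 / q = 1\<close>, it integrates to exactly
    \<open>U * V\<close>.\<close>
  let ?g = "\<lambda>t. U * V * (u t powr p / (p * X) + v t powr q / (q * Y))"
  have "(?g has_integral U * V * (X / (p * X) + Y / (q * Y))) S"
    using has_integral_mult_right[OF has_integral_add[OF has_integral_divide[OF X] has_integral_divide[OF Y]]]
    by blast
  moreover have "U * V * (X / (p * X) + Y / (q * Y)) = U * V"
    using assms(3-5) by simp
  ultimately have g: "(?g has_integral U * V) S"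
    by metis
  have le: "norm (w t) \<le> ?g t" if "t \<in> S" for t
  proof -
    have "(u t / U) * (v t / V) \<le> (u t / U) powr p / p + (v t / V) powr q / q"
      using assms(1-3) w[OF that] UV by (intro Youngs_inequality) auto
    also have "\<dots> = u t powr p / (p * X) + v t powr q / (q * Y)"
      using UV w[OF that] by (simp add: powr_divide mult.commute)
    finally have "u t * v t \<le> ?g t"
      using UV(1,2) by (simp add: field_simps)
    with w[OF that] show ?thesis by simp
  qed
  have "norm (integral S w) \<le> integral S ?g"
    using W g le by (intro Henstock_Kurzweil_Integration.integral_norm_bound_integral) auto
  then show ?thesis
    unfolding integral_unique[OF W] integral_unique[OF g] by (simp add: U_def V_def)
qed

text \<open>The single formula \<open>?G\<close> is an antiderivative on both sides of
  \<open>m\<close>. It is continuous, so the fundamental theorem tolerates \<open>m\<close> as an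
  exceptional point, and on each side \<open>?G\<close> is a plain power of the distance to
  \<open>m\<close>.\<close>

lemma has_integral_abs_diff_powr:
  fixes c d m p :: real
  assumes "p > 0" "c \<le> d"
  shows "((\<lambda>t. \<bar>t - m\<bar> powr p) has_integral
    (\<bar>d - m\<bar> powr p * (d - m) - \<bar>c - m\<bar> powr p * (c - m)) / (p + 1)) {c..d}"
proof -
  let ?G = "\<lambda>t. \<bar>t - m\<bar> powr p * (t - m) / (p + 1)"
  have "((\<lambda>t. \<bar>t - m\<bar> powr p) has_integral ?G d - ?G c) {c..d}"
  proof (rule fundamental_theorem_of_calculus_strong[where S = "{m}"])
    show "continuous_on {c..d} ?G"
      using assms by (intro continuous_intros continuous_on_powr') auto
    fix t assume t: "t \<in> {c..d} - {m}"
    then have "m < t \<or> t < m" by auto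
    then have "(?G has_real_derivative \<bar>t - m\<bar> powr p) (at t)"
    proof
      assume tm: "m < t"
      have "((\<lambda>t. (t - m) powr (p + 1) / (p + 1)) has_real_derivative \<bar>t - m\<bar> powr p) (at t)"
        using tm assms by (auto intro!: derivative_eq_intros)
      then show ?thesis
        by (rule has_field_derivative_transform_within_open[where S = "{m<..}"]) (use tm in \<open>auto simp: powr_add algebra_simps\<close>)
    next
      assume tm: "t < m"
      have "((\<lambda>t. - ((m - t) powr (p + 1)) / (p + 1)) has_real_derivative \<bar>t - m\<bar> powr p) (at t)"
        using tm assms by (auto intro!: derivative_eq_intros)
      then show ?thesis
        by (rule has_field_derivative_transform_within_open[where S = "{..<m}"]) (use tm in \<open>auto simp: powr_add algebra_simps\<close>)
    qed
    then show "(?G has_vector_derivative \<bar>t - m\<bar> powr p) (at t)"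
      by (simp add: has_real_derivative_iff_has_vector_derivative)
  qed (use assms in auto)
  then show ?thesis by (simp add: diff_divide_distrib)
qed

lemma has_integral_linear_interpolation:
  fixes c d \<alpha> \<beta> :: real
  assumes "c < d"
  shows "((\<lambda>t. (\<beta> - \<alpha>) / (d - c) * (t - c) + \<alpha>) has_integral (d - c) * (\<alpha> + \<beta>) / 2) {c..d}"
proof -
  let ?G = "\<lambda>t. (\<beta> - \<alpha>) / (d - c) * (t - c)\<^sup>2 / 2 + \<alpha> * t"
  have "((\<lambda>t. (\<beta> - \<alpha>) / (d - c) * (t - c) + \<alpha>) has_integral ?G d - ?G c) {c..d}"
    using assms
    by (intro fundamental_theorem_of_calculus)
       (auto intro!: derivative_eq_intros
          simp: has_real_derivative_iff_has_vector_derivative[symmetric] divide_simps,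
        auto simp: algebra_simps)
  moreover have "?G d - ?G c = (d - c) * (\<alpha> + \<beta>) / 2"
    using assms by (simp add: power2_eq_square field_simps)
  ultimately show ?thesis by metis
qed

text \<open>Dividing by \<open>A + B\<close> turns the summands into numbers of
  \<open>[0, 1]\<close> with sum 1, and raising such numbers to a power \<open>q\<close> at least 1
  does not increase them.\<close>

lemma powr_add_powr_le_add_powr:
  fixes A B q :: real
  assumes "A \<ge> 0" "B \<ge> 0" "q \<ge> 1"
  shows "A powr q + B powr q \<le> (A + B) powr q"
proof (cases "A + B = 0")
  case True
  with assms have "A = 0" "B = 0" by auto
  then show ?thesis by simp
next
  case False
  define s where "s = A + B"
  have s: "s > 0" using False assms by (simp add: s_def)
  have *: "(y / s) powr q \<le> y / s" if "0 \<le> y" "y \<le> s" for y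
    using powr_mono'[of 1 q "y / s"] that s assms(3) by simp
  have "(A / s) powr q + (B / s) powr q \<le> A / s + B / s"
    using assms by (intro add_mono *) (auto simp: s_def)
  also have "\<dots> = 1"
    using s by (simp add: s_def add_divide_distrib[symmetric])
  finally show ?thesis
    using s assms by (simp add: powr_divide s_def[symmetric] field_simps)
qed

text \<open>The fundamental theorem is applied to \<open>(m - t) * f t\<close> with \<open>m\<close>
  the midpoint. The factor \<open>m - t\<close> is \<open>(d - c) / 2\<close> at \<open>c\<close>
  and its negative at \<open>d\<close>, so the boundary terms are minus the trapezoid.\<close>

lemma has_integral_trapezoid_error:
  fixes f f' :: "real \<Rightarrow> real"
  assumes "c \<le> d"
    and f': "\<And>t. t \<in> {c..d} \<Longrightarrow> (f has_real_derivative f' t) (at t)"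
  shows "((\<lambda>t. ((c + d) / 2 - t) * f' t) has_integral
    integral {c..d} f - (f c + f d) / 2 * (d - c)) {c..d}"
proof -
  let ?F = "\<lambda>t. ((c + d) / 2 - t) * f t"
  have "(?F has_real_derivative ((c + d) / 2 - t) * f' t - f t) (at t)" if "t \<in> {c..d}" for t
    by (rule derivative_eq_intros f'[OF that] refl | simp)+
  then have "((\<lambda>t. ((c + d) / 2 - t) * f' t - f t) has_integral ?F d - ?F c) {c..d}"
    using assms(1)
    by (intro fundamental_theorem_of_calculus)
       (simp_all add: has_real_derivative_iff_has_vector_derivative has_vector_derivative_at_within)
  moreover have "continuous_on {c..d} f"
    using f' by (blast intro: continuous_at_imp_continuous_on DERIV_isCont)
  then have "(f has_integral integral {c..d} f) {c..d}"
    by (simp add: integrable_continuous_real integrable_integral)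
  ultimately have "((\<lambda>t. ((c + d) / 2 - t) * f' t - f t + f t) has_integral
      ?F d - ?F c + integral {c..d} f) {c..d}"
    by (rule has_integral_add)
  moreover have "?F d - ?F c + integral {c..d} f = integral {c..d} f - (f c + f d) / 2 * (d - c)"
    by (simp add: field_simps)
  ultimately show ?thesis by simp
qed

lemma trapezoid_error_le:
  fixes f f' :: "real \<Rightarrow> real" and c d p q :: real
  assumes "c < d" "p > 1" "q > 1" "1 / p + 1 / q = 1"
    and f': "\<And>t. t \<in> {c..d} \<Longrightarrow> (f has_real_derivative f' t) (at t)"
    and conv: "convex_on {c..d} (\<lambda>t. \<bar>f' t\<bar> powr q)"
  shows "\<bar>integral {c..d} f - (f c + f d) / 2 * (d - c)\<bar> \<le>
    (1 / (p + 1)) powr (1 / p) * (1 / 2) powr (1 / q) *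
      ((d - c)\<^sup>2 / 2 * (\<bar>f' c\<bar> + \<bar>f' d\<bar>))"
proof -
  define W where "W = integral {c..d} f - (f c + f d) / 2 * (d - c)"
  define h m where "h = d - c" and "m = (c + d) / 2"
  define \<alpha> \<beta> where "\<alpha> = \<bar>f' c\<bar> powr q" and "\<beta> = \<bar>f' d\<bar> powr q"
  \<comment> \<open>The chord of the convex function \<open>\<bar>f' t\<bar> powr q\<close> over the
    cell.\<close>
  define L where "L = (\<lambda>t. (\<beta> - \<alpha>) / (d - c) * (t - c) + \<alpha>)"
  have h: "h > 0" using assms by (simp add: h_def)
  have W: "((\<lambda>t. (m - t) * f' t) has_integral W) {c..d}"
    using has_integral_trapezoid_error[of c d f f'] assms by (simp add: W_def m_def)
  have le_L: "\<bar>f' t\<bar> powr q \<le> L t" if "t \<in> {c..d}" for t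
    using convex_onD_Icc'[OF conv that] by (simp add: L_def \<alpha>_def \<beta>_def)
  have L_nonneg: "0 \<le> L t" if "t \<in> {c..d}" for t
    using le_L[OF that] powr_ge_zero order_trans by blast
  have le: "\<bar>f' t\<bar> \<le> L t powr (1 / q)" if "t \<in> {c..d}" for t
    using powr_mono2[of "1 / q", OF _ _ le_L[OF that]] assms(3) by (simp add: powr_powr)
  show ?thesis
  \<comment> \<open>The Holder bound needs a positive integral of \<open>L\<close>. If the sum
    vanishes, so does \<open>L\<close>, hence \<open>f'\<close> on the whole cell.\<close>
  proof (cases "\<alpha> + \<beta> = 0")
    case True
    then have "\<alpha> = 0" "\<beta> = 0"
      using powr_ge_zero by (auto simp: \<alpha>_def \<beta>_def add_nonneg_eq_0_iff)
    then have "f' t = 0" if "t \<in> {c..d}" for t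
      using le[OF that] by (simp add: L_def)
    then have "((\<lambda>t. (m - t) * f' t) has_integral 0) {c..d}"
      by (intro has_integral_is_0) auto
    with W have "W = 0" by (rule has_integral_unique)
    then show ?thesis by (simp add: W_def)
  next
    case False
    then have pos: "\<alpha> + \<beta> > 0"
      using powr_ge_zero by (simp add: \<alpha>_def \<beta>_def less_le)
    \<comment> \<open>Both ends lie at distance \<open>h / 2\<close> from \<open>m\<close>, and each
      half of the cell contributes \<open>(h / 2) powr (p + 1) / (p + 1)\<close>.\<close>
    define X where "X = (h / 2) powr p * h / (p + 1)"
    have dm: "d - m = h / 2" "c - m = - (h / 2)" by (auto simp: h_def m_def field_simps)
    have X: "((\<lambda>t. \<bar>t - m\<bar> powr p) has_integral X) {c..d}"
      using has_integral_abs_diff_powr[of p c d m] assms h by (simp add: dm X_def algebra_simps)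
    \<comment> \<open>The two powers cancel because \<open>L\<close> is nonnegative on the
      cell.\<close>
    have "((\<lambda>t. (L t powr (1 / q)) powr q) has_integral h * (\<alpha> + \<beta>) / 2) {c..d}"
      using has_integral_linear_interpolation[OF assms(1), of \<beta> \<alpha>] L_nonneg assms(3)
      by (subst has_integral_cong[of _ _ L]) (auto simp: powr_powr L_def h_def)
    with X W have "\<bar>W\<bar> \<le> X powr (1 / p) * (h * (\<alpha> + \<beta>) / 2) powr (1 / q)"
      using assms(2-4) h pos le
      by (intro Holder_has_integral_le[where S = "{c..d}" and u = "\<lambda>t. \<bar>t - m\<bar>"
            and v = "\<lambda>t. L t powr (1 / q)" and w = "\<lambda>t. (m - t) * f' t"])
         (auto simp: X_def abs_mult abs_minus_commute intro!: mult_left_mono)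
    also have "X powr (1 / p) = h / 2 * h powr (1 / p) * (1 / (p + 1)) powr (1 / p)"
      using h assms(2) by (simp add: X_def powr_mult powr_divide powr_powr)
    also have "(h * (\<alpha> + \<beta>) / 2) powr (1 / q) =
        h powr (1 / q) * (\<alpha> + \<beta>) powr (1 / q) * (1 / 2) powr (1 / q)"
      using h pos by (simp add: powr_mult powr_divide)
    \<comment> \<open>The powers of \<open>h\<close> are grouped so that the conjugate exponents
      merge into one further factor \<open>h\<close>, giving \<open>h * h / 2\<close> in
      total.\<close>
    also have "h / 2 * h powr (1 / p) * (1 / (p + 1)) powr (1 / p) *
        (h powr (1 / q) * (\<alpha> + \<beta>) powr (1 / q) * (1 / 2) powr (1 / q)) =
        (1 / (p + 1)) powr (1 / p) * (1 / 2) powr (1 / q) *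
        (h * (h powr (1 / p) * h powr (1 / q)) / 2 * (\<alpha> + \<beta>) powr (1 / q))"
      by (simp add: mult_ac)
    also have "h powr (1 / p) * h powr (1 / q) = h"
      using h assms(4) by (simp add: powr_add[symmetric])
    also have "(\<alpha> + \<beta>) powr (1 / q) \<le> \<bar>f' c\<bar> + \<bar>f' d\<bar>"
    proof -
      have "(\<alpha> + \<beta>) powr (1 / q) \<le> ((\<bar>f' c\<bar> + \<bar>f' d\<bar>) powr q) powr (1 / q)"
        using pos assms(3) unfolding \<alpha>_def \<beta>_def
        by (intro powr_mono2 powr_add_powr_le_add_powr) auto
      then show ?thesis using assms(3) by (simp add: powr_powr)
    qed
    finally show ?thesis
      using h by (simp add: W_def h_def power2_eq_square mult_left_mono)
  qed
qed

lemma is_division_bounds: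
  assumes "is_division a b n x" "k \<le> n"
  shows "a \<le> x k" "x k \<le> b"
proof -
  have step: "x i \<le> x (Suc i)" if "i < n" for i
    using assms(1) that unfolding is_division_def by (meson less_imp_le)
  have mono: "x i \<le> x j" if "i \<le> j" "j \<le> n" for i j
    using that
  proof (induction rule: dec_induct)
    case (step k)
    then show ?case
      using \<open>\<And>i. i < n \<Longrightarrow> x i \<le> x (Suc i)\<close>[of k] by simp
  qed simp
  from mono[of 0 k] mono[of k n] show "a \<le> x k" "x k \<le> b"
    using assms by (auto simp: is_division_def)
qed

lemma trapezoidal_error_eq_sum:
  assumes "is_division a b n x" "f integrable_on {a..b}"
  shows "trapezoidal_error f n x =
    (\<Sum>i<n. integral {x i..x (Suc i)} f - (f (x i) + f (x (Suc i))) / 2 * (x (Suc i) - x i))"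
proof -
  \<comment> \<open>Additivity of the integral, by induction over initial segments; \<open>k\<close>
    stays at most \<open>n\<close> because later values of \<open>x\<close> are arbitrary.\<close>
  have "(\<Sum>i<k. integral {x i..x (Suc i)} f) = integral {x 0..x k} f" if "k \<le> n" for k
    using that
  proof (induction k)
    case (Suc k)
    then have "x k \<le> x (Suc k)" "x 0 = a"
      using assms(1) unfolding is_division_def by (auto intro: less_imp_le)
    moreover have "a \<le> x k" "x (Suc k) \<le> b"
      using is_division_bounds[OF assms(1)] Suc.prems by auto
    moreover from this have "f integrable_on {a..x (Suc k)}"
      by (intro integrable_on_subinterval[OF assms(2)]) auto
    ultimately show ?case
      using Suc Henstock_Kurzweil_Integration.integral_combine[of a "x k" "x (Suc k)" f] by simp
  qed auto
  then show ?thesis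
    by (simp add: trapezoidal_error_def trapezoidal_sum_def sum_subtractf)
qed

theorem proposition3:
  fixes I :: "real set" and f :: "real \<Rightarrow> real" and a b p q :: real
    and n :: nat and x :: "nat \<Rightarrow> real"
  assumes "is_interval I"
    and "\<forall>t\<in>interior I. f differentiable (at t)"
    and "a \<in> interior I" and "b \<in> interior I" and "a < b"
    and "deriv f absolutely_integrable_on {a..b}"
    and "p > 1" and "q = p / (p - 1)"
    and "convex_on {a..b} (\<lambda>t. \<bar>deriv f t\<bar> powr (p / (p - 1)))"
    and "is_division a b n x"
  shows "\<bar>trapezoidal_error f n x\<bar> \<le>
    (1 / (p + 1)) powr (1 / p) * (1 / 2) powr (1 / q) *
    (\<Sum>i<n. (x (Suc i) - x i)\<^sup>2 / 2 * (\<bar>deriv f (x i)\<bar> + \<bar>deriv f (x (Suc i))\<bar>))"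
proof -
  \<comment> \<open>Convexity places all of \<open>{a..b}\<close> in the interior, so
    \<open>f\<close> has a two-sided derivative even at \<open>a\<close> and
    \<open>b\<close>.\<close>
  have "convex (interior I)"
    using assms(1) is_interval_convex_1 by (simp add: convex_interior)
  then have "{a..b} \<subseteq> interior I"
    using assms(3-5) closed_segment_subset[of a "interior I" b]
    by (simp add: closed_segment_eq_real_ivl)
  then have D: "(f has_real_derivative deriv f t) (at t)" if "t \<in> {a..b}" for t
    using assms(2) that DERIV_deriv_iff_real_differentiable by blast
  then have "continuous_on {a..b} f"
    by (blast intro: continuous_at_imp_continuous_on DERIV_isCont)
  then have int: "f integrable_on {a..b}"
    by (rule integrable_continuous_real)
  have q: "q > 1" "1 / p + 1 / q = 1"
    using assms(7) unfolding assms(8) by (simp_all add: diff_divide_distrib less_divide_eq)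
  \<comment> \<open>Each cell lies in \<open>{a..b}\<close> and inherits differentiability and
    convexity, so the bound for a single cell applies.\<close>
  have step: "\<bar>integral {x i..x (Suc i)} f - (f (x i) + f (x (Suc i))) / 2 * (x (Suc i) - x i)\<bar> \<le>
      (1 / (p + 1)) powr (1 / p) * (1 / 2) powr (1 / q) *
      ((x (Suc i) - x i)\<^sup>2 / 2 * (\<bar>deriv f (x i)\<bar> + \<bar>deriv f (x (Suc i))\<bar>))"
    if "i < n" for i
  proof (rule trapezoid_error_le)
    have sub: "{x i..x (Suc i)} \<subseteq> {a..b}"
      using is_division_bounds[OF assms(10)] that by auto
    show "x i < x (Suc i)"
      using assms(10) that by (simp add: is_division_def)
    show "(f has_real_derivative deriv f t) (at t)" if "t \<in> {x i..x (Suc i)}" for t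
      using D sub that by blast
    show "convex_on {x i..x (Suc i)} (\<lambda>t. \<bar>deriv f t\<bar> powr q)"
      using assms(8,9) convex_on_subset[OF _ sub] by (simp add: convex_real_interval)
  qed (use assms(7) q in auto)
  \<comment> \<open>The error is the sum of the cell errors; the triangle inequality and the cell
    bounds finish the proof.\<close>
  show ?thesis
    unfolding trapezoidal_error_eq_sum[OF assms(10) int] sum_distrib_left
    using step by (intro order_trans[OF sum_abs] sum_mono) auto
qed

end
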